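(* Let $L$ be a finite-dimensional Lie algebra over a field $F$. Then $L$ is supersolvable if and only if every maximal subalgebra $M$ of $L$ has an element $C\in S(M)$ with $\dim C/k(C)=1$.
   Context: $L$ is supersolvable if there is a chain $0=L_0\subset\cdots\subset L_n=L$ of ideals of $L$ with one-dimensional successive quotients. For a nonzero subalgebra $X$ of $L$, the strict core $k(X)$ is the sum of all ideals of $L$ that are proper subalgebras of $X$ (it is $0$ if there are none). For a maximal subalgebra $M$, a subalgebra $C$ is a completion of $M$ if $C\not\subseteq M$ but every proper subalgebra of $C$ that is an ideal of $L$ is contained in $M$; $I(M)$ is the set of completions. A subalgebra $C$ is a subideal of $L$ if there is a chain $C=C_0\subseteq C_1\subseteq\cdots\subseteq C_n=L$ with each $C_i$ an ideal of $C_{i+1}$. $S(M)=\{C\in I(M): C \text{ is a subideal of } L \text{ and } L=M+C\}$. *)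

theory Defs
  imports Complex_Main
begin

text \<open>A Lie algebra over a field 'a: the whole type 'v is the underlying vector space L,
  with scalar multiplication sc and bracket br.\<close>

definition lie_algebra :: "('a::field \<Rightarrow> 'v::ab_group_add \<Rightarrow> 'v) \<Rightarrow> ('v \<Rightarrow> 'v \<Rightarrow> 'v) \<Rightarrow> bool" where
  "lie_algebra sc br \<longleftrightarrow> vector_space sc
     \<and> (\<forall>x y z. br (x + y) z = br x z + br y z)
     \<and> (\<forall>x y z. br x (y + z) = br x y + br x z)
     \<and> (\<forall>c x y. br (sc c x) y = sc c (br x y))
     \<and> (\<forall>c x y. br x (sc c y) = sc c (br x y))
     \<and> (\<forall>x. br x x = 0)
     \<and> (\<forall>x y z. br x (br y z) + br y (br z x) + br z (br x y) = 0)"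

definition fin_dim :: "('a::field \<Rightarrow> 'v::ab_group_add \<Rightarrow> 'v) \<Rightarrow> bool" where
  "fin_dim sc \<longleftrightarrow> (\<exists>B. finite B \<and> module.span sc B = UNIV)"

definition lie_subalgebra :: "('a::field \<Rightarrow> 'v::ab_group_add \<Rightarrow> 'v) \<Rightarrow> ('v \<Rightarrow> 'v \<Rightarrow> 'v) \<Rightarrow> 'v set \<Rightarrow> bool" where
  "lie_subalgebra sc br A \<longleftrightarrow> module.subspace sc A \<and> (\<forall>x\<in>A. \<forall>y\<in>A. br x y \<in> A)"

definition lie_ideal_in :: "('a::field \<Rightarrow> 'v::ab_group_add \<Rightarrow> 'v) \<Rightarrow> ('v \<Rightarrow> 'v \<Rightarrow> 'v) \<Rightarrow> 'v set \<Rightarrow> 'v set \<Rightarrow> bool" where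
  "lie_ideal_in sc br A B \<longleftrightarrow> lie_subalgebra sc br B \<and> module.subspace sc A \<and> A \<subseteq> B
     \<and> (\<forall>x\<in>B. \<forall>y\<in>A. br x y \<in> A)"

definition lie_ideal :: "('a::field \<Rightarrow> 'v::ab_group_add \<Rightarrow> 'v) \<Rightarrow> ('v \<Rightarrow> 'v \<Rightarrow> 'v) \<Rightarrow> 'v set \<Rightarrow> bool" where
  "lie_ideal sc br A \<longleftrightarrow> lie_ideal_in sc br A UNIV"

definition supersolvable :: "('a::field \<Rightarrow> 'v::ab_group_add \<Rightarrow> 'v) \<Rightarrow> ('v \<Rightarrow> 'v \<Rightarrow> 'v) \<Rightarrow> bool" where
  "supersolvable sc br \<longleftrightarrow> (\<exists>(n::nat) Ls. Ls 0 = {0} \<and> Ls n = UNIV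
     \<and> (\<forall>i\<le>n. lie_ideal sc br (Ls i))
     \<and> (\<forall>i<n. Ls i \<subset> Ls (Suc i) \<and> vector_space.dim sc (Ls (Suc i)) = vector_space.dim sc (Ls i) + 1))"

definition maximal_subalgebra :: "('a::field \<Rightarrow> 'v::ab_group_add \<Rightarrow> 'v) \<Rightarrow> ('v \<Rightarrow> 'v \<Rightarrow> 'v) \<Rightarrow> 'v set \<Rightarrow> bool" where
  "maximal_subalgebra sc br M \<longleftrightarrow> lie_subalgebra sc br M \<and> M \<noteq> UNIV
     \<and> (\<forall>N. lie_subalgebra sc br N \<and> M \<subseteq> N \<longrightarrow> N = M \<or> N = UNIV)"

definition strict_core :: "('a::field \<Rightarrow> 'v::ab_group_add \<Rightarrow> 'v) \<Rightarrow> ('v \<Rightarrow> 'v \<Rightarrow> 'v) \<Rightarrow> 'v set \<Rightarrow> 'v set" where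
  "strict_core sc br X = module.span sc (\<Union>{I. lie_ideal sc br I \<and> I \<subset> X})"

definition completions :: "('a::field \<Rightarrow> 'v::ab_group_add \<Rightarrow> 'v) \<Rightarrow> ('v \<Rightarrow> 'v \<Rightarrow> 'v) \<Rightarrow> 'v set \<Rightarrow> 'v set set" where
  "completions sc br M = {C. lie_subalgebra sc br C \<and> \<not> C \<subseteq> M
     \<and> (\<forall>I. lie_ideal sc br I \<and> I \<subset> C \<longrightarrow> I \<subseteq> M)}"

definition subideal :: "('a::field \<Rightarrow> 'v::ab_group_add \<Rightarrow> 'v) \<Rightarrow> ('v \<Rightarrow> 'v \<Rightarrow> 'v) \<Rightarrow> 'v set \<Rightarrow> bool" where
  "subideal sc br C \<longleftrightarrow> (\<exists>(n::nat) Cs. Cs 0 = C \<and> Cs n = UNIV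
     \<and> (\<forall>i<n. lie_ideal_in sc br (Cs i) (Cs (Suc i))))"

definition S_set :: "('a::field \<Rightarrow> 'v::ab_group_add \<Rightarrow> 'v) \<Rightarrow> ('v \<Rightarrow> 'v \<Rightarrow> 'v) \<Rightarrow> 'v set \<Rightarrow> 'v set set" where
  "S_set sc br M = {C \<in> completions sc br M. subideal sc br C
     \<and> {m + c | m c. m \<in> M \<and> c \<in> C} = UNIV}"

end

theory Submission
  imports Defs
begin

text \<open>
  Supersolvable to completions: given a maximal subalgebra \<open>M\<close>, an ideal \<open>C\<close> of least dimension
  not contained in \<open>M\<close> works, since a flag of ideals of \<open>L\<close> meets \<open>C\<close> in an ideal of codimension one.

  Conversely, build the flag upwards: for an ideal \<open>N\<close> and an ideal \<open>A\<close> minimal over \<open>N\<close> such that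
  \<open>L/A\<close> has a flag, we need \<open>dim A/N = 1\<close>. Everything is phrased modulo \<open>N\<close> inside \<open>L\<close>, so that
  no quotient algebras are formed.

  If some maximal \<open>M\<close> contains \<open>N\<close> but not \<open>A\<close>, the completion has the form \<open>C = k(C) + Fx\<close> and
  \<open>L = M + Fx\<close>. A descent along the subideal chain of \<open>C\<close> shows that \<open>K = {y \<in> M. [x, y] \<in> M}\<close>
  and \<open>K + Fx\<close> are ideals of \<open>L\<close>, and \<open>A/N\<close> embeds into \<open>(K + Fx)/K\<close>.

  Otherwise \<open>A\<close> lies in every maximal subalgebra containing \<open>N\<close>. The generalised eigenvectors of
  \<open>ad t\<close> with eigenvalues in \<open>F\<close> (or with eigenvalue \<open>0\<close>, if \<open>t\<close> is in \<open>A\<close> or a commutator) form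
  a subalgebra which, by the Fitting decomposition and the flag of \<open>L/A\<close>, together with \<open>A\<close> spans
  \<open>L\<close>; hence it is \<open>L\<close>. Engel's theorem then makes \<open>A/N\<close> abelian. Climbing the flag, each of
  its members acts on \<open>A/N\<close> by scalars: an eigenspace is an ideal because commutators act
  nilpotently. This replaces Lie's theorem and is valid in every characteristic.
\<close>

locale fin_dim_lie = finite_dimensional_vector_space sc Basis
  for sc :: "'a::field \<Rightarrow> 'v::ab_group_add \<Rightarrow> 'v" (infixr \<open>*s\<close> 75) and Basis :: "'v set" +
  fixes br :: "'v \<Rightarrow> 'v \<Rightarrow> 'v"
  assumes lie_algebra: "lie_algebra sc br"
begin

abbreviation "subalg \<equiv> lie_subalgebra sc br"
abbreviation "ideal \<equiv> lie_ideal sc br"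
abbreviation "max_subalg \<equiv> maximal_subalgebra sc br"

section \<open>Calculus of the bracket\<close>

lemma br_add_left: "br (x + y) z = br x z + br y z"
  and br_add_right: "br x (y + z) = br x y + br x z"
  and br_scale_left: "br (c *s x) y = c *s br x y"
  and br_scale_right: "br x (c *s y) = c *s br x y"
  and br_self [simp]: "br x x = 0"
  and jacobi: "br x (br y z) + br y (br z x) + br z (br x y) = 0"
  using lie_algebra unfolding lie_algebra_def by blast+

lemma br_zero_left [simp]: "br 0 y = 0"
  using br_scale_left[of 0 0 y] by simp

lemma br_zero_right [simp]: "br x 0 = 0"
  using br_scale_right[of x 0 0] by simp

lemma br_minus_left: "br (- x) y = - br x y"
  using br_add_left[of x "- x" y] by (simp add: eq_neg_iff_add_eq_0 add.commute)

lemma br_minus_right: "br x (- y) = - br x y"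
  using br_add_right[of x y "- y"] by (simp add: eq_neg_iff_add_eq_0 add.commute)

lemma br_diff_left: "br (x - y) z = br x z - br y z"
  using br_add_left[of x "- y" z] by (simp add: br_minus_left)

lemma br_diff_right: "br x (y - z) = br x y - br x z"
  using br_add_right[of x y "- z"] by (simp add: br_minus_right)

lemma br_swap: "br x y = - br y x"
proof -
  have "br x y + br y x = 0"
    using br_self[of "x + y"] unfolding br_add_left br_add_right by (simp add: add.commute)
  then show ?thesis by (simp add: eq_neg_iff_add_eq_0)
qed

lemmas br_linear = br_add_left br_add_right br_scale_left br_scale_right
  br_minus_left br_minus_right br_diff_left br_diff_right

lemma br_br: "br x (br y z) = br (br x y) z + br y (br x z)"
proof -
  have "br y (br z x) = - br y (br x z)" "br z (br x y) = - br (br x y) z"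
    using br_swap[of z x] br_swap[of z "br x y"] by (simp_all add: br_minus_right)
  then show ?thesis using jacobi[of x y z] by (simp add: algebra_simps)
qed

section \<open>Subalgebras and ideals\<close>

lemma subalg_iff: "subalg A \<longleftrightarrow> subspace A \<and> (\<forall>x\<in>A. \<forall>y\<in>A. br x y \<in> A)"
  by (simp add: lie_subalgebra_def)

lemma ideal_iff: "ideal A \<longleftrightarrow> subspace A \<and> (\<forall>x. \<forall>y\<in>A. br x y \<in> A)"
  by (auto simp: lie_ideal_def lie_ideal_in_def lie_subalgebra_def)

lemma ideal_subspace: "ideal A \<Longrightarrow> subspace A"
  by (simp add: ideal_iff)

lemma ideal_br: "ideal A \<Longrightarrow> y \<in> A \<Longrightarrow> br x y \<in> A"
  by (simp add: ideal_iff)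

lemma ideal_br': "ideal A \<Longrightarrow> y \<in> A \<Longrightarrow> br y x \<in> A"
  using br_swap[of y x] by (auto simp: ideal_iff intro: subspace_neg)

lemma ideal_subalg: "ideal A \<Longrightarrow> subalg A"
  by (simp add: ideal_iff subalg_iff)

lemma ideal_UNIV: "ideal UNIV"
  by (simp add: ideal_iff)

lemma ideal_Int: "ideal A \<Longrightarrow> ideal B \<Longrightarrow> ideal (A \<inter> B)"
  by (simp add: ideal_iff subspace_inter)

section \<open>Subspaces and codimension one\<close>

lemma span_eq_self: "subspace S \<Longrightarrow> span S = S"
  by (simp only: span_eq_iff)

lemma dim_less: "subspace S \<Longrightarrow> subspace T \<Longrightarrow> S \<subset> T \<Longrightarrow> dim S < dim T"
  using dim_psubset[of S T] by (simp add: span_eq_self)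

lemma mem_span_insert: "subspace S \<Longrightarrow> x \<in> span (insert u S) \<longleftrightarrow> (\<exists>k. x - k *s u \<in> S)"
  using span_breakdown_eq[of x u S] by (simp add: span_eq_self)

lemma dim_span_insert: "subspace S \<Longrightarrow> u \<notin> S \<Longrightarrow> dim (span (insert u S)) = dim S + 1"
  by (simp add: dim_insert span_eq_self)

text \<open>S + Fu lies strictly above \<open>S\<close> and inside \<open>T\<close>, so by dimension
  it is all of \<open>T\<close>.\<close>

lemma codim1_decomp:
  assumes S: "subspace S" and T: "subspace T" "S \<subseteq> T" and d: "dim T \<le> dim S + 1"
    and u: "u \<in> T" "u \<notin> S" and t: "t \<in> T"
  obtains c where "t - c *s u \<in> S"
proof -
  have "span (insert u S) \<subseteq> T" using T u by (simp add: span_minimal)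
  then have "span (insert u S) = T"
    using d dim_span_insert[OF S u(2)] T by (intro subspace_dim_equal) auto
  then show ?thesis using t mem_span_insert[OF S] that by blast
qed

lemma subspace_scale_cancel: "subspace S \<Longrightarrow> c \<noteq> 0 \<Longrightarrow> c *s v \<in> S \<Longrightarrow> v \<in> S"
  using subspace_scale[of S "c *s v" "inverse c"] by simp

lemma subspace_diff_cancel: "subspace S \<Longrightarrow> y \<in> S \<Longrightarrow> x - y \<in> S \<longleftrightarrow> x \<in> S"
  using subspace_add[of S "x - y" y] subspace_diff by auto

section \<open>Extremal dimension and maximal subalgebras\<close>

lemma exists_max_dim:
  assumes "P S"
  obtains M where "P M" "S \<subseteq> M" "\<And>N. P N \<Longrightarrow> S \<subseteq> N \<Longrightarrow> dim N \<le> dim M"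
proof -
  let ?Q = "\<lambda>m. P m \<and> S \<subseteq> m"
  have "\<exists>M. ?Q M \<and> (\<forall>N. ?Q N \<longrightarrow> dim N \<le> dim M)"
    by (rule ex_has_greatest_nat[of ?Q S dim "Suc dimension"])
       (use assms dim_subset_UNIV in \<open>auto simp: less_Suc_eq_le\<close>)
  then show ?thesis using that by blast
qed

lemma exists_min_dim:
  fixes P :: "'v set \<Rightarrow> bool"
  assumes "P S"
  obtains M where "P M" "\<And>N. P N \<Longrightarrow> dim M \<le> dim N"
  using ex_has_least_nat[of P S dim] assms that by blast

text \<open>A proper subalgebra above \<open>S\<close> of greatest dimension is maximal: a proper
  subalgebra containing it cannot have larger dimension, so the two agree.\<close>

lemma subalg_in_max_subalg:
  assumes "subalg S" "S \<noteq> UNIV"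
  obtains M where "max_subalg M" "S \<subseteq> M"
proof -
  obtain M where M: "subalg M \<and> M \<noteq> UNIV" "S \<subseteq> M"
    "\<And>N. subalg N \<and> N \<noteq> UNIV \<Longrightarrow> S \<subseteq> N \<Longrightarrow> dim N \<le> dim M"
    using exists_max_dim[of "\<lambda>M. subalg M \<and> M \<noteq> UNIV" S] assms by blast
  have "N = M" if "subalg N" "M \<subseteq> N" "N \<noteq> UNIV" for N
    using that M(1,2) M(3)[of N] subspace_dim_equal[of M N] unfolding subalg_iff by blast
  then have "max_subalg M" using M(1) unfolding maximal_subalgebra_def by blast
  then show ?thesis using that M(2) by blast
qed

subsection \<open>Generalised eigenspaces and the Fitting decomposition\<close>

text \<open>The vectors that some product of operators ad t - c with c in \<open>S\<close> sends
  into \<open>N\<close>; for an ideal \<open>N\<close>, the sum modulo \<open>N\<close> of the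
  generalised eigenspaces of ad t with eigenvalues in \<open>S\<close>. The inductive form peels off
  one factor at a time. For \<open>S = {0}\<close>, equality with \<open>UNIV\<close> says that ad t
  is nilpotent modulo \<open>N\<close>.\<close>

inductive_set gen_eig :: "'v set \<Rightarrow> 'a set \<Rightarrow> 'v \<Rightarrow> 'v set" for N S t where
  base: "v \<in> N \<Longrightarrow> v \<in> gen_eig N S t"
| step: "c \<in> S \<Longrightarrow> br t v - c *s v \<in> gen_eig N S t \<Longrightarrow> v \<in> gen_eig N S t"

text \<open>The operators ad t - c and ad t - d commute and preserve \<open>N\<close>, so the
  factors that bring \<open>v\<close> into \<open>N\<close> do the same to its shift. Here
  \<open>c\<close> need not lie in \<open>S\<close>.\<close>

lemma gen_eig_shift:
  assumes "ideal N" "v \<in> gen_eig N S t"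
  shows "br t v - c *s v \<in> gen_eig N S t"
  using assms(2)
proof induction
  case (base v)
  then show ?case using assms(1)
    by (intro gen_eig.base) (simp add: ideal_br ideal_subspace subspace_diff subspace_scale)
next
  case (step d v)
  have "br t (br t v - c *s v) - d *s (br t v - c *s v)
      = br t (br t v - d *s v) - c *s (br t v - d *s v)"
    by (simp add: br_linear scale_right_diff_distrib mult.commute)
  then show ?case using gen_eig.step[OF step.hyps(1), of t "br t v - c *s v" N] step.IH by simp
qed

lemma gen_eig_add_base:
  assumes "ideal N" "w \<in> gen_eig N S t" "v \<in> N"
  shows "v + w \<in> gen_eig N S t"
  using assms(2,3)
proof (induction arbitrary: v)
  case (base w)
  then show ?case using assms(1) by (intro gen_eig.base) (simp add: ideal_subspace subspace_add)
next
  case (step c w)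
  have "br t (v + w) - c *s (v + w) = (br t v - c *s v) + (br t w - c *s w)"
    by (simp add: br_linear scale_right_distrib)
  moreover have "br t v - c *s v \<in> N"
    using assms(1) step.prems by (simp add: ideal_br ideal_subspace subspace_diff subspace_scale)
  ultimately show ?case
    using step.IH gen_eig.step[OF step.hyps(1), of t "v + w" N] by simp
qed

text \<open>Each factor peeled off \<open>v\<close> is applied to \<open>w\<close> as well, which is
  harmless by \<open>gen_eig_shift\<close>.\<close>

lemma gen_eig_add:
  assumes "ideal N" "v \<in> gen_eig N S t" "w \<in> gen_eig N S t"
  shows "v + w \<in> gen_eig N S t"
  using assms(2,3)
proof (induction arbitrary: w)
  case (base v)
  then show ?case using gen_eig_add_base[OF assms(1)] by blast
next
  case (step c v)
  have "br t (v + w) - c *s (v + w) = (br t v - c *s v) + (br t w - c *s w)"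
    by (simp add: br_linear scale_right_distrib)
  then show ?case
    using step.IH[OF gen_eig_shift[OF assms(1) step.prems]]
      gen_eig.step[OF step.hyps(1), of t "v + w" N] by simp
qed

lemma gen_eig_scale:
  assumes "ideal N" "v \<in> gen_eig N S t"
  shows "k *s v \<in> gen_eig N S t"
  using assms(2)
proof induction
  case (base v)
  then show ?case using assms(1) by (intro gen_eig.base) (simp add: ideal_subspace subspace_scale)
next
  case (step c v)
  have "br t (k *s v) - c *s (k *s v) = k *s (br t v - c *s v)"
    by (simp add: br_linear scale_right_diff_distrib mult.commute)
  then show ?case using step.IH gen_eig.step[OF step.hyps(1), of t "k *s v" N] by simp
qed

text \<open>Since ad t is a derivation, (ad t - (c + d)) [v, w] = [(ad t - c) v, w] +
  [v, (ad t - d) w]. The induction on \<open>w\<close> is nested in the one on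
  \<open>v\<close>.\<close>

lemma gen_eig_br:
  assumes N: "ideal N" and S: "\<And>c d. c \<in> S \<Longrightarrow> d \<in> S \<Longrightarrow> c + d \<in> S"
    and "v \<in> gen_eig N S t" "w \<in> gen_eig N S t"
  shows "br v w \<in> gen_eig N S t"
  using assms(3,4)
proof (induction arbitrary: w)
  case (base v)
  then show ?case using N by (intro gen_eig.base) (simp add: ideal_br')
next
  case (step c v)
  note IHv = step.IH and c = step.hyps(1)
  show ?case using step.prems
  proof induction
    case (base w)
    then show ?case using N by (intro gen_eig.base) (simp add: ideal_br)
  next
    case (step d w)
    have "br t (br v w) - (c + d) *s br v w = br (br t v - c *s v) w + br v (br t w - d *s w)"
      unfolding br_br[of t v w] by (simp add: br_linear scale_left_distrib)
    moreover have "br (br t v - c *s v) w \<in> gen_eig N S t"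
      using IHv gen_eig.step[OF step.hyps] by blast
    ultimately show ?case
      using step.IH gen_eig.step[OF S[OF c step.hyps(1)], of t "br v w" N] gen_eig_add[OF N] by simp
  qed
qed

lemma gen_eig_subalg:
  assumes "ideal N" "\<And>c d. c \<in> S \<Longrightarrow> d \<in> S \<Longrightarrow> c + d \<in> S"
  shows "subalg (gen_eig N S t)"
  unfolding subalg_iff subspace_def
  using assms gen_eig_add gen_eig_scale gen_eig_br
    gen_eig.base[OF subspace_0[OF ideal_subspace[OF assms(1)]]] by simp

lemma subspace_shift_image:
  assumes "subspace A"
  shows "subspace ((\<lambda>v. br t v - c *s v) ` A)"
  unfolding subspace_def
proof (intro conjI ballI allI)
  let ?T = "\<lambda>v. br t v - c *s v"
  show "0 \<in> ?T ` A" using subspace_0[OF assms] by (intro image_eqI[of _ _ 0]) simp_all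
  show "x + y \<in> ?T ` A" if xy: "x \<in> ?T ` A" "y \<in> ?T ` A" for x y
  proof -
    obtain a b where "a \<in> A" "b \<in> A" "x = ?T a" "y = ?T b" using xy by blast
    moreover from this have "x + y = ?T (a + b)" by (simp add: br_linear scale_right_distrib)
    ultimately show ?thesis using subspace_add[OF assms] by blast
  qed
  show "k *s x \<in> ?T ` A" if x: "x \<in> ?T ` A" for k x
  proof -
    obtain a where "a \<in> A" "x = ?T a" using x by blast
    moreover from this have "k *s x = ?T (k *s a)"
      by (simp add: br_linear scale_right_diff_distrib mult.commute)
    ultimately show ?thesis using subspace_scale[OF assms] by blast
  qed
qed

text \<open>With \<open>T\<close> = ad t - c, the images of \<open>A\<close> under powers of
  \<open>T\<close> decrease and become stationary at some \<open>n\<close>. Then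
  \<open>(T ^^ n) a = (T ^^ n) (T b)\<close> for some \<open>b\<close> in \<open>A\<close>, and
  \<open>a - T b\<close> is killed by \<open>T ^^ n\<close>.\<close>

lemma fitting:
  assumes A: "ideal A" and N: "ideal N" and c: "c \<in> S" and a: "a \<in> A"
  obtains b where "b \<in> A" "a - (br t b - c *s b) \<in> gen_eig N S t"
proof -
  define T where "T = (\<lambda>v. br t v - c *s v)"
  have TA: "T ` A \<subseteq> A"
    using A by (auto simp: T_def ideal_br ideal_subspace subspace_diff subspace_scale)
  have sub: "subspace ((T ^^ n) ` A)" for n
  proof (induction n)
    case (Suc n)
    then show ?case using subspace_shift_image[of "(T ^^ n) ` A" t c]
      by (simp add: T_def image_comp)
  qed (use A in \<open>simp add: ideal_subspace\<close>)
  obtain n where n: "\<And>m. dim ((T ^^ n) ` A) \<le> dim ((T ^^ m) ` A)"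
    using ex_has_least_nat[of "\<lambda>_. True" 0 "\<lambda>n. dim ((T ^^ n) ` A)"] by blast
  have eq: "(T ^^ Suc n) ` A = (T ^^ n) ` (T ` A)"
    by (simp add: image_comp funpow_Suc_right del: funpow.simps)
  have "(T ^^ Suc n) ` A = (T ^^ n) ` A"
    using image_mono[OF TA] by (intro subspace_dim_equal[OF sub sub _ n]) (simp only: eq)
  then have "(T ^^ n) a \<in> (T ^^ n) ` (T ` A)" using a unfolding eq by simp
  then obtain b where b: "b \<in> A" "(T ^^ n) a = (T ^^ n) (T b)" by blast
  have T_diff: "(T ^^ m) (v - w) = (T ^^ m) v - (T ^^ m) w" for m v w
  proof (induction m)
    case (Suc m)
    then show ?case by (simp add: T_def br_linear scale_right_diff_distrib)
  qed simp
  have pull: "(T ^^ m) v \<in> gen_eig N S t \<Longrightarrow> v \<in> gen_eig N S t" for m v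
  proof (induction m)
    case (Suc m)
    then show ?case using gen_eig.step[OF c, of t "(T ^^ m) v" N] by (simp add: T_def)
  qed simp
  have "(T ^^ n) (a - T b) \<in> gen_eig N S t"
    using b N by (simp add: T_diff gen_eig.base ideal_subspace subspace_0)
  then show ?thesis using that b(1) pull unfolding T_def by blast
qed

text \<open>Apply the factors to \<open>v\<close> one after the other: the last vector before
  \<open>U\<close> is entered is an eigenvector modulo \<open>U\<close>, and it stays in
  \<open>W\<close> because \<open>W\<close> is stable.\<close>

lemma gen_eig_eigenvector:
  assumes "v \<in> gen_eig N S t" "v \<in> W" "v \<notin> U" "N \<subseteq> U" "subspace W"
    and W: "\<And>w. w \<in> W \<Longrightarrow> br t w \<in> W"
  obtains c w where "c \<in> S" "w \<in> W" "w \<notin> U" "br t w - c *s w \<in> U"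
proof -
  have "\<exists>c\<in>S. \<exists>w\<in>W. w \<notin> U \<and> br t w - c *s w \<in> U"
    using assms(1-3)
  proof induction
    case (base v)
    then show ?case using assms(4) by blast
  next
    case (step c v)
    have "br t v - c *s v \<in> W"
      using step.prems W assms(5) by (simp add: subspace_diff subspace_scale)
    then show ?case using step by blast
  qed
  then show ?thesis using that by blast
qed

text \<open>Modulo \<open>N\<close> each factor multiplies the eigenvector by l - c. Were every such
  scalar nonzero, the vector would never enter \<open>N\<close>.\<close>

lemma gen_eig_eigenvalue:
  assumes N: "ideal N" and "v \<in> gen_eig N S t" "v \<notin> N" "br t v - l *s v \<in> N"
  shows "l \<in> S"
  using assms(2-4)
proof induction
  case (step c v)
  let ?v = "br t v - c *s v"
  note sub = ideal_subspace[OF N]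
  show ?case
  proof (cases "l = c")
    case False
    have "?v = (br t v - l *s v) + (l - c) *s v" by (simp add: scale_left_diff_distrib)
    then have "?v \<notin> N"
      using False step.prems subspace_scale_cancel[OF sub, of "l - c" v]
        subspace_diff[OF sub, of ?v "br t v - l *s v"] by auto
    moreover have "br t ?v - l *s ?v = br t (br t v - l *s v) - c *s (br t v - l *s v)"
      by (simp add: br_linear scale_right_diff_distrib mult.commute)
    then have "br t ?v - l *s ?v \<in> N"
      using step.prems N sub by (simp add: ideal_br subspace_diff subspace_scale)
    ultimately show ?thesis using step.IH by blast
  qed (use step in blast)
qed simp

subsection \<open>Engel's theorem\<close>

text \<open>The action on V/U is kept general so that the induction on \<open>dim K\<close> can use
  the hypothesis twice for a subalgebra \<open>H\<close> of \<open>K\<close>: on K/H to find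
  \<open>x\<close> normalising \<open>H\<close>, and on V/U to find vectors killed by
  \<open>H\<close>.\<close>

lemma engel:
  assumes N: "ideal N"
  shows "subalg K \<Longrightarrow> N \<subseteq> K \<Longrightarrow> (\<And>y. y \<in> K \<Longrightarrow> gen_eig N {0} y = UNIV) \<Longrightarrow>
    subspace U \<Longrightarrow> subspace V \<Longrightarrow> N \<subseteq> U \<Longrightarrow> U \<subset> V \<Longrightarrow>
    (\<And>y u. y \<in> K \<Longrightarrow> u \<in> U \<Longrightarrow> br y u \<in> U) \<Longrightarrow> (\<And>y u. y \<in> K \<Longrightarrow> u \<in> V \<Longrightarrow> br y u \<in> V) \<Longrightarrow>
    \<exists>v\<in>V. v \<notin> U \<and> (\<forall>y\<in>K. br y v \<in> U)"
proof (induction "dim K" arbitrary: K U V rule: less_induct)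
  case less
  note K = less.prems(1-2) and nil = less.prems(3) and U = less.prems(4,6) and V = less.prems(5)
    and UV = less.prems(7) and KU = less.prems(8) and KV = less.prems(9)
  show ?case
  proof (cases "K = N")
    case True
    obtain v where "v \<in> V" "v \<notin> U" using UV by blast
    then show ?thesis using True N U(2) ideal_br' by blast
  next
    case False
    let ?P = "\<lambda>H. subalg H \<and> H \<subset> K"
    obtain H where H: "?P H" "N \<subseteq> H" and max: "\<And>H'. ?P H' \<Longrightarrow> N \<subseteq> H' \<Longrightarrow> dim H' \<le> dim H"
      using exists_max_dim[of ?P N] False K ideal_subalg[OF N] by blast
    have sub: "subspace H" "subspace K" using H K by (auto simp: subalg_iff)
    have HK: "br y u \<in> H" if "y \<in> H" "u \<in> H" for y u using H(1) that by (simp add: subalg_iff)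
    have KK: "br y u \<in> K" if "y \<in> K" "u \<in> K" for y u using K(1) that by (simp add: subalg_iff)
    have lt: "dim H < dim K" using dim_less sub H(1) by blast
    note IH = less.hyps[OF lt]
    have sH: "subalg H" "H \<subset> K" using H by auto
    \<comment> \<open>First use of the induction hypothesis, with \<open>H\<close> and
      \<open>K\<close> in place of \<open>U\<close> and \<open>V\<close>. By the choice of
      \<open>H\<close>, the resulting \<open>x\<close> satisfies K = H + Fx.\<close>
    have "\<exists>v\<in>K. v \<notin> H \<and> (\<forall>y\<in>H. br y v \<in> H)"
      by (rule IH) (use sH H(2) sub nil HK KK in blast)+
    then obtain x where x: "x \<in> K" "x \<notin> H" "\<And>y. y \<in> H \<Longrightarrow> br y x \<in> H" by blast
    define H' where "H' = span (insert x H)"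
    have H': "y \<in> H' \<longleftrightarrow> (\<exists>k. y - k *s x \<in> H)" for y
      using mem_span_insert[OF sub(1)] by (simp add: H'_def)
    have "br y z \<in> H'" if yz: "y \<in> H'" "z \<in> H'" for y z
    proof -
      obtain k l where k: "y - k *s x \<in> H" and l: "z - l *s x \<in> H" using yz H' by blast
      have "br y z = br (y - k *s x) (z - l *s x) + l *s br (y - k *s x) x - k *s br (z - l *s x) x"
        using br_swap[of x z] by (simp add: br_linear scale_right_diff_distrib)
      then have "br y z \<in> H"
        using HK[OF k l] x(3)[OF k] x(3)[OF l] sub(1)
        by (simp add: subspace_add subspace_diff subspace_scale)
      then show ?thesis using span_base[of "br y z" "insert x H"] by (simp add: H'_def)
    qed
    then have "subalg H'" by (simp add: subalg_iff H'_def)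
    moreover have "H' \<subseteq> K" unfolding H'_def using x(1) sH(2) sub by (intro span_minimal) auto
    moreover have "H \<subseteq> H'" unfolding H'_def using span_superset by blast
    moreover have "dim H' = dim H + 1" unfolding H'_def using dim_span_insert[OF sub(1) x(2)] .
    ultimately have KH': "K = H'" using max[of H'] H(2) by auto
    \<comment> \<open>The vectors of \<open>V\<close> that \<open>H\<close> kills modulo
      \<open>U\<close>; they are stable under ad x because \<open>x\<close> normalises
      \<open>H\<close>. The second use of the hypothesis shows that \<open>W\<close> is not inside
      \<open>U\<close>.\<close>
    define W where "W = {w \<in> V. \<forall>y\<in>H. br y w \<in> U}"
    have W: "subspace W" unfolding W_def subspace_def
      using V U(1) by (simp add: br_linear subspace_add subspace_scale subspace_0)
    have "\<exists>v\<in>V. v \<notin> U \<and> (\<forall>y\<in>H. br y v \<in> U)"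
      by (rule IH) (use sH H(2) U V UV nil KU KV in blast)+
    then obtain v where v: "v \<in> W" "v \<notin> U" unfolding W_def by blast
    have xW: "br x w \<in> W" if w: "w \<in> W" for w
    proof -
      have "br y (br x w) \<in> U" if y: "y \<in> H" for y
        unfolding br_br[of y x w] using x(1) x(3)[OF y] y w KU U(1)
        by (simp add: W_def subspace_add)
      then show ?thesis using w KV[OF x(1)] by (simp add: W_def)
    qed
    \<comment> \<open>As ad x is nilpotent modulo \<open>N\<close>, some vector of \<open>W\<close>
      outside \<open>U\<close> is killed by \<open>x\<close> too, hence by all of
      \<open>K\<close>.\<close>
    have "v \<in> gen_eig N {0} x" using nil[OF x(1)] by simp
    then obtain c w where w: "c \<in> {0}" "w \<in> W" "w \<notin> U" "br x w - c *s w \<in> U"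
      using gen_eig_eigenvector[OF _ v U(2) W xW] by blast
    have "br y w \<in> U" if "y \<in> K" for y
    proof -
      obtain k where k: "y - k *s x \<in> H" using \<open>y \<in> K\<close> KH' H' by blast
      have "br y w = br (y - k *s x) w + k *s br x w" by (simp add: br_linear)
      then show ?thesis using k w U(1) by (simp add: W_def subspace_add subspace_scale)
    qed
    then show ?thesis using w unfolding W_def by blast
  qed
qed

subsection \<open>Flags of ideals\<close>

text \<open>A supersolvability flag of L/A, written with ideals of L. Starting at an arbitrary
  \<open>A\<close> allows the flag to be built from the top down.\<close>

definition ideal_flag :: "'v set \<Rightarrow> nat \<Rightarrow> (nat \<Rightarrow> 'v set) \<Rightarrow> bool" where
  "ideal_flag A n Ls \<longleftrightarrow> Ls 0 = A \<and> Ls n = UNIV \<and> (\<forall>i\<le>n. ideal (Ls i))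
     \<and> (\<forall>i<n. Ls i \<subset> Ls (Suc i) \<and> dim (Ls (Suc i)) = dim (Ls i) + 1)"

lemma supersolvable_iff_flag: "supersolvable sc br \<longleftrightarrow> (\<exists>n Ls. ideal_flag {0} n Ls)"
  unfolding supersolvable_def ideal_flag_def ..

lemma ideal_flag_Cons:
  assumes flag: "ideal_flag A n Ls" and N: "ideal N" "N \<subset> A" "dim A = dim N + 1"
  shows "ideal_flag N (Suc n) (case_nat N Ls)"
  using assms unfolding ideal_flag_def by (auto split: nat.split simp: less_Suc_eq_0_disj)

lemma codim1_eigenvalue:
  assumes I: "ideal I" and J: "ideal J" "I \<subset> J" "dim J = dim I + 1"
  obtains c where "\<And>l. l \<in> J \<Longrightarrow> br t l - c *s l \<in> I"
proof -
  note subI = ideal_subspace[OF I] and subJ = ideal_subspace[OF J(1)]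
  obtain u where u: "u \<in> J" "u \<notin> I" using J by blast
  have dec: "\<exists>c. l - c *s u \<in> I" if l: "l \<in> J" for l
    using codim1_decomp[OF subI subJ _ _ u l] J by auto
  obtain c where c: "br t u - c *s u \<in> I" using dec ideal_br[OF J(1) u(1)] by blast
  have "br t l - c *s l \<in> I" if l: "l \<in> J" for l
  proof -
    obtain k where k: "l - k *s u \<in> I" using dec[OF l] by blast
    have "br t l - c *s l = br t (l - k *s u) - c *s (l - k *s u) + k *s (br t u - c *s u)"
      by (simp add: br_linear scale_right_diff_distrib mult.commute)
    then show ?thesis
      using k c subI I by (simp add: ideal_br subspace_add subspace_diff subspace_scale)
  qed
  then show ?thesis using that by blast
qed

text \<open>L acts on the one-dimensional J/I by scalars, and scalars commute.\<close>

lemma codim1_commutator: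
  assumes I: "ideal I" and J: "ideal J" "I \<subset> J" "dim J = dim I + 1" and l: "l \<in> J"
  shows "br (br y x) l \<in> I"
proof -
  obtain a where a: "br x l - a *s l \<in> I" using codim1_eigenvalue[OF I J] l by blast
  obtain b where b: "br y l - b *s l \<in> I" using codim1_eigenvalue[OF I J] l by blast
  have "br (br y x) l = br y (br x l) - br x (br y l)" using br_br[of y x l] by simp
  also have "\<dots> = br y (br x l - a *s l) - br x (br y l - b *s l)
      + (a *s (br y l - b *s l) - b *s (br x l - a *s l))"
    by (simp add: br_linear scale_right_diff_distrib mult.commute)
  finally show ?thesis
    using a b ideal_subspace[OF I] I
    by (simp add: ideal_br subspace_add subspace_diff subspace_scale)
qed

text \<open>L = A + \<open>gen_eig N S t\<close> once the eigenvalues of ad t on the factors of the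
  flag lie in \<open>S\<close>; shown by climbing the flag.\<close>

lemma gen_eig_complement:
  assumes N: "ideal N" and flag: "ideal_flag A n Ls"
    and S: "\<And>i. i < n \<Longrightarrow> \<exists>c\<in>S. \<forall>l\<in>Ls (Suc i). br t l - c *s l \<in> Ls i"
  shows "\<exists>a\<in>A. l - a \<in> gen_eig N S t"
proof -
  have A: "ideal A" using flag by (auto simp: ideal_flag_def)
  have "\<exists>a\<in>A. l - a \<in> gen_eig N S t" if "i \<le> n" "l \<in> Ls i" for i l
    using that
  proof (induction i arbitrary: l)
    case 0
    then have "l \<in> A" "l - l \<in> gen_eig N S t"
      using flag N by (auto simp: ideal_flag_def gen_eig.base ideal_subspace subspace_0)
    then show ?case by blast
  next
    case (Suc i)
    then obtain c where c: "c \<in> S" "br t l - c *s l \<in> Ls i" using S[of i] by auto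
    with Suc obtain a where a: "a \<in> A" "br t l - c *s l - a \<in> gen_eig N S t" by force
    \<comment> \<open>The error \<open>a\<close> is split by Fitting into an image under ad t - c,
      absorbed by replacing \<open>l\<close> with \<open>l - b\<close>, and a generalised
      eigenvector.\<close>
    obtain b where b: "b \<in> A" "a - (br t b - c *s b) \<in> gen_eig N S t"
      using fitting[OF A N c(1) a(1)] .
    have "br t (l - b) - c *s (l - b) = (br t l - c *s l - a) + (a - (br t b - c *s b))"
      by (simp add: br_linear scale_right_diff_distrib)
    then have "l - b \<in> gen_eig N S t"
      using gen_eig_add[OF N a(2) b(2)] gen_eig.step[OF c(1), of t "l - b" N] by simp
    then show ?case using b(1) by blast
  qed
  from this[of n l] show ?thesis using flag by (simp add: ideal_flag_def)
qed

subsection \<open>Minimal ideals inside all maximal subalgebras\<close>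

text \<open>If this subalgebra were proper, a maximal subalgebra above it would contain
  \<open>N\<close>, hence \<open>A\<close>, hence A + \<open>gen_eig N S t\<close> = L.\<close>

lemma gen_eig_eq_UNIV:
  assumes N: "ideal N" and flag: "ideal_flag A n Ls" and fr: "\<And>M. max_subalg M \<Longrightarrow> N \<subseteq> M \<Longrightarrow> A \<subseteq> M"
    and S: "\<And>c d. c \<in> S \<Longrightarrow> d \<in> S \<Longrightarrow> c + d \<in> S"
    and ev: "\<And>i. i < n \<Longrightarrow> \<exists>c\<in>S. \<forall>l\<in>Ls (Suc i). br t l - c *s l \<in> Ls i"
  shows "gen_eig N S t = UNIV"
proof (rule ccontr)
  assume "gen_eig N S t \<noteq> UNIV"
  then obtain M where M: "max_subalg M" "gen_eig N S t \<subseteq> M"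
    using subalg_in_max_subalg gen_eig_subalg[OF N S] by blast
  have sub: "subspace M" and ne: "M \<noteq> UNIV" using M(1) by (auto simp: maximal_subalgebra_def subalg_iff)
  have "N \<subseteq> M" using M(2) gen_eig.base by blast
  then have "A \<subseteq> M" using fr M(1) by blast
  have "l \<in> M" for l
  proof -
    obtain a where "a \<in> A" "l - a \<in> gen_eig N S t" using gen_eig_complement[OF N flag, of S t l] ev by blast
    then show ?thesis using \<open>A \<subseteq> M\<close> M(2) subspace_diff_cancel[OF sub, of a l] by blast
  qed
  then show False using ne by blast
qed

lemma frattini_chief_factor_dim:
  assumes N: "ideal N" and A: "N \<subset> A"
    and min: "\<And>I. ideal I \<Longrightarrow> N \<subset> I \<Longrightarrow> I \<subseteq> A \<Longrightarrow> I = A"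
    and flag: "ideal_flag A n Ls" and fr: "\<And>M. max_subalg M \<Longrightarrow> N \<subseteq> M \<Longrightarrow> A \<subseteq> M"
  shows "dim A = dim N + 1"
proof -
  have idA: "ideal A" and id: "\<And>i. i \<le> n \<Longrightarrow> ideal (Ls i)"
    and st: "\<And>i. i < n \<Longrightarrow> Ls i \<subset> Ls (Suc i) \<and> dim (Ls (Suc i)) = dim (Ls i) + 1"
    using flag by (auto simp: ideal_flag_def)
  note subN = ideal_subspace[OF N] and subA = ideal_subspace[OF idA]
  have A_le: "A \<subseteq> Ls i" if "i \<le> n" for i
    using that
  proof (induction i)
    case (Suc i)
    then show ?case using st[of i] by auto
  qed (use flag in \<open>simp add: ideal_flag_def\<close>)
  have all: "gen_eig N UNIV t = UNIV" for t
  proof (rule gen_eig_eq_UNIV[OF N flag fr])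
    fix i assume i: "i < n"
    obtain c where "\<And>l. l \<in> Ls (Suc i) \<Longrightarrow> br t l - c *s l \<in> Ls i"
      using codim1_eigenvalue[OF id id] st[OF i] i by (metis Suc_leI less_imp_le)
    then show "\<exists>c\<in>UNIV. \<forall>l\<in>Ls (Suc i). br t l - c *s l \<in> Ls i" by blast
  qed simp_all
  have nilp_comm: "gen_eig N {0} (br y x) = UNIV" for y x
  proof (rule gen_eig_eq_UNIV[OF N flag fr])
    fix i assume i: "i < n"
    have "br (br y x) l \<in> Ls i" if "l \<in> Ls (Suc i)" for l
      by (rule codim1_commutator[OF id id _ _ that]) (use st[OF i] i in auto)
    then show "\<exists>c\<in>{0}. \<forall>l\<in>Ls (Suc i). br (br y x) l - c *s l \<in> Ls i" by simp
  qed simp_all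
  have nilp_A: "gen_eig N {0} a = UNIV" if a: "a \<in> A" for a
  proof (rule gen_eig_eq_UNIV[OF N flag fr])
    fix i assume i: "i < n"
    \<comment> \<open>[a, L] lies in \<open>A\<close> and so in every member of the flag: all
      eigenvalues on its factors are 0.\<close>
    have "br a l \<in> Ls i" for l
      using ideal_br'[OF idA a, of l] A_le[of i] i by auto
    then show "\<exists>c\<in>{0}. \<forall>l\<in>Ls (Suc i). br a l - c *s l \<in> Ls i" by simp
  qed simp_all
  have abel: "br a v \<in> N" if "a \<in> A" "v \<in> A" for a v
  proof -
    \<comment> \<open>The centraliser in \<open>A\<close> of A/N. It is an ideal, Engel makes it
      larger than \<open>N\<close>, and minimality then gives \<open>Z = A\<close>.\<close>
    define Z where "Z = {v \<in> A. \<forall>a\<in>A. br a v \<in> N}"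
    have "subspace Z" unfolding Z_def subspace_def
      using subA subN by (simp add: br_linear subspace_add subspace_scale subspace_0)
    moreover have "br x v \<in> Z" if v: "v \<in> Z" for x v
    proof -
      have "br b (br x v) \<in> N" if b: "b \<in> A" for b
        unfolding br_br[of b x v]
        using v b N subN ideal_br'[OF idA b, of x] by (simp add: Z_def subspace_add ideal_br)
      then show ?thesis using v idA by (simp add: Z_def ideal_br)
    qed
    ultimately have Z: "ideal Z" by (simp add: ideal_iff)
    have "\<exists>v\<in>A. v \<notin> N \<and> (\<forall>y\<in>A. br y v \<in> N)"
      by (rule engel[OF N])
        (use A nilp_A subN subA ideal_subalg[OF idA] ideal_br[OF N] ideal_br[OF idA] in blast)+
    moreover have "N \<subseteq> Z" using A ideal_br[OF N] by (auto simp: Z_def)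
    ultimately have "N \<subset> Z" unfolding Z_def by blast
    then have "Z = A" using min[OF Z] by (auto simp: Z_def)
    then show ?thesis using that by (auto simp: Z_def)
  qed
  have scalar: "\<exists>c. \<forall>v\<in>A. br y v - c *s v \<in> N" if "i \<le> n" "y \<in> Ls i" for i y
    using that
  proof (induction i arbitrary: y)
    case 0
    then have "\<forall>v\<in>A. br y v - 0 *s v \<in> N" using abel flag by (simp add: ideal_flag_def)
    then show ?case by blast
  next
    case (Suc i)
    then have i: "i < n" "i \<le> n" by simp_all
    show ?case
    proof (cases "y \<in> Ls i")
      case True
      then show ?thesis using Suc.IH i by blast
    next
      case y: False
      obtain v0 where v0: "v0 \<in> A" "v0 \<notin> N" using A by blast
      have "v0 \<in> gen_eig N UNIV y" using all by simp
      then obtain c v1 where c: "v1 \<in> A" "v1 \<notin> N" "br y v1 - c *s v1 \<in> N"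
        using gen_eig_eigenvector[OF _ v0 _ subA] ideal_br[OF idA] by (metis order_refl)
      \<comment> \<open>An eigenspace of \<open>y\<close> on A/N. Once it is shown to be an ideal of
        L, minimality makes it all of \<open>A\<close>, so \<open>y\<close> acts by the scalar
        \<open>c\<close>.\<close>
      define W where "W = {v \<in> A. br y v - c *s v \<in> N}"
      have "subspace W"
        unfolding subspace_def
      proof (intro conjI ballI allI)
        show "0 \<in> W" using subA subN by (simp add: W_def subspace_0)
        fix v w k assume v: "v \<in> W"
        have "br y (k *s v) - c *s (k *s v) = k *s (br y v - c *s v)"
          by (simp add: br_linear scale_right_diff_distrib mult.commute)
        then show "k *s v \<in> W" using v subA subN by (simp add: W_def subspace_scale)
        assume w: "w \<in> W"
        have "br y (v + w) - c *s (v + w) = (br y v - c *s v) + (br y w - c *s w)"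
          by (simp add: br_linear scale_right_distrib)
        then show "v + w \<in> W" using v w subA subN by (simp add: W_def subspace_add)
      qed
      moreover have "br x v \<in> W" if v: "v \<in> W" for x v
      proof (cases "v \<in> N")
        case True
        then have "br x v \<in> N" "br y (br x v) \<in> N" using N by (simp_all add: ideal_br)
        then show ?thesis using subN A by (auto simp: W_def subspace_diff subspace_scale)
      next
        case False
        \<comment> \<open>\<open>z\<close> lies in \<open>Ls (Suc i)\<close>, so it is a multiple of
          \<open>y\<close> plus an element of \<open>Ls i\<close>, which acts on A/N by a scalar
          \<open>d\<close> by induction. Hence \<open>v\<close> is an eigenvector of
          \<open>z\<close> modulo \<open>N\<close>.\<close>
        define z where "z = br y x"
        have "z \<in> Ls (Suc i)" using ideal_br'[OF id Suc.prems(2)] i by (simp add: z_def)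
        then obtain k where k: "z - k *s y \<in> Ls i"
          using codim1_decomp[of "Ls i" "Ls (Suc i)" y z] st[OF i(1)] id i y Suc.prems
          by (metis ideal_subspace order_refl psubset_imp_subset)
        then obtain d where d: "\<forall>v\<in>A. br (z - k *s y) v - d *s v \<in> N" using Suc.IH i(2) by blast
        \<comment> \<open>\<open>z\<close> is a commutator, so it acts nilpotently; hence its eigenvalue on \<open>v\<close> vanishes.\<close>
        have "br z v - (d + k * c) *s v
            = (br (z - k *s y) v - d *s v) + k *s (br y v - c *s v)"
          by (simp add: br_linear scale_right_diff_distrib scale_left_distrib)
        then have zv: "br z v - (d + k * c) *s v \<in> N"
          using d v subN by (simp add: W_def subspace_add subspace_scale)
        then have "d + k * c \<in> {0}"
          using gen_eig_eigenvalue[OF N _ False] nilp_comm by (metis UNIV_I z_def)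
        then have "br z v \<in> N" using zv by simp
        moreover have "br y (br x v) - c *s br x v = br z v + br x (br y v - c *s v)"
          unfolding br_br[of y x v] by (simp add: br_linear z_def)
        ultimately show ?thesis
          using v N subN idA by (simp add: W_def ideal_br subspace_add)
      qed
      ultimately have W: "ideal W" by (simp add: ideal_iff)
      have "N \<subseteq> W" using A N subN by (auto simp: W_def ideal_br subspace_diff subspace_scale)
      then have "N \<subset> W" using c by (auto simp: W_def)
      then have "W = A" using min[OF W] by (auto simp: W_def)
      then show ?thesis by (auto simp: W_def)
    qed
  qed
  \<comment> \<open>L acts on A/N by scalars, so N + Fv is an ideal for any such \<open>v\<close>,
    and minimality gives A = N + Fv.\<close>
  obtain v where v: "v \<in> A" "v \<notin> N" using A by blast
  define I where "I = span (insert v N)"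
  have I: "y \<in> I \<longleftrightarrow> (\<exists>k. y - k *s v \<in> N)" for y
    using mem_span_insert[OF subN] by (simp add: I_def)
  have "br x y \<in> I" if y: "y \<in> I" for x y
  proof -
    obtain k where k: "y - k *s v \<in> N" using y I by blast
    obtain c where c: "br x v - c *s v \<in> N" using scalar[of n x] flag v by (auto simp: ideal_flag_def)
    have "br x y - (k * c) *s v = br x (y - k *s v) + k *s (br x v - c *s v)"
      by (simp add: br_linear scale_right_diff_distrib)
    then have "br x y - (k * c) *s v \<in> N"
      using k c N subN by (simp add: ideal_br subspace_add subspace_scale)
    then show ?thesis using I by blast
  qed
  then have "ideal I" by (simp add: ideal_iff I_def)
  moreover have "N \<subset> I" using span_superset[of "insert v N"] v by (auto simp: I_def)
  moreover have "I \<subseteq> A" unfolding I_def using v A subA by (intro span_minimal) auto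
  ultimately have "I = A" using min by blast
  then show ?thesis using dim_span_insert[OF subN v(2)] by (simp add: I_def)
qed

subsection \<open>Maximal subalgebras complemented by a subideal\<close>

text \<open>\<open>Cs\<close> is the subideal chain of the completion \<open>Cs 0\<close>. The
  strict core enters only through \<open>C_Int_M\<close>: elements of \<open>Cs 0\<close> in
  \<open>M\<close> lie in ideals of L inside \<open>M\<close>. Once shown to be an ideal,
  \<open>K\<close> is the largest ideal of L inside \<open>M\<close>.\<close>

context
  fixes M :: "'v set" and x :: 'v and n :: nat and Cs :: "nat \<Rightarrow> 'v set" and K :: "'v set"
  assumes M: "subalg M" and xM: "x \<notin> M" and codim: "\<And>l. \<exists>c. l - c *s x \<in> M"
    and Cs_top: "Cs n = UNIV" and Cs_step: "\<And>i. i < n \<Longrightarrow> lie_ideal_in sc br (Cs i) (Cs (Suc i))"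
    and xC: "x \<in> Cs 0"
    and C_Int_M: "\<And>y. y \<in> Cs 0 \<Longrightarrow> y \<in> M \<Longrightarrow> \<exists>I. ideal I \<and> I \<subseteq> M \<and> y \<in> I"
  defines "K \<equiv> {y \<in> M. br x y \<in> M}"
begin

lemma M_subspace: "subspace M"
  using M by (simp add: subalg_iff)

lemma M_br: "a \<in> M \<Longrightarrow> b \<in> M \<Longrightarrow> br a b \<in> M"
  using M by (simp add: subalg_iff)

lemma K_subspace: "subspace K"
  unfolding K_def subspace_def
  using M_subspace by (simp add: br_linear subspace_add subspace_scale subspace_0)

lemma x_mem_chain: "i \<le> n \<Longrightarrow> x \<in> Cs i"
proof (induction i)
  case (Suc i)
  then show ?case using Cs_step[of i] by (auto simp: lie_ideal_in_def)
qed (use xC in simp)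

lemma chain_subspace: "i \<le> n \<Longrightarrow> subspace (Cs i)"
  using Cs_step[of i] Cs_top by (cases "i = n") (auto simp: lie_ideal_in_def)

lemma chain_br:
  assumes "i < n" "a \<in> Cs i" "b \<in> Cs (Suc i)"
  shows "br a b \<in> Cs i"
proof -
  have "br b a \<in> Cs i" using Cs_step[OF assms(1)] assms by (auto simp: lie_ideal_in_def)
  then show ?thesis using br_swap[of a b] chain_subspace[of i] assms(1) subspace_neg by simp
qed

text \<open>Expand [x, [m, e]] by Jacobi: [x, m] is c x modulo \<open>M\<close>, and [x, e] is in
  \<open>M\<close> by definition of \<open>K\<close>.\<close>

lemma K_br_M:
  assumes m: "m \<in> M" and e: "e \<in> K"
  shows "br m e \<in> K"
proof -
  obtain c where c: "br x m - c *s x \<in> M" using codim by blast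
  have "br x (br m e) = br (br x m - c *s x) e + c *s br x e + br m (br x e)"
    unfolding br_br[of x m e] by (simp add: br_linear)
  then show ?thesis
    using c m e M_subspace by (simp add: K_def M_br subspace_add subspace_scale)
qed

text \<open>If \<open>h = [x, e] \<notin> K\<close> for some \<open>e \<in> K\<close>, then \<open>[h, e]\<close> has the same property
  and lies one step lower in the subideal chain.\<close>

lemma K_br_x:
  assumes "e \<in> K"
  shows "br x e \<in> K"
proof -
  \<comment> \<open>Induction up the chain; at \<open>m = n\<close> the intersection is
    \<open>K\<close>. At the bottom, \<open>e\<close> lies in an ideal of L inside \<open>M\<close>,
    which absorbs repeated brackets with \<open>x\<close>.\<close>
  have "\<forall>e \<in> K \<inter> Cs m. br x e \<in> K" if "m \<le> n" for m
    using that
  proof (induction m)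
    case 0
    show ?case
    proof
      fix e assume "e \<in> K \<inter> Cs 0"
      then obtain I where I: "ideal I" "I \<subseteq> M" "e \<in> I" using C_Int_M by (auto simp: K_def)
      then have "br x e \<in> I" "br x (br x e) \<in> I" by (simp_all add: ideal_br)
      then show "br x e \<in> K" using I by (auto simp: K_def)
    qed
  next
    case (Suc m)
    then have m: "m < n" by simp
    show ?case
    proof (rule ballI, rule ccontr)
      fix e assume e: "e \<in> K \<inter> Cs (Suc m)" and "br x e \<notin> K"
      define h where "h = br x e"
      have h: "h \<notin> K" "h \<in> M" "h \<in> Cs m"
        using \<open>br x e \<notin> K\<close> e chain_br[OF m x_mem_chain] m by (auto simp: h_def K_def)
      then have "br x h \<notin> M" by (simp add: K_def)
      obtain f where f: "br x h - f *s x \<in> M" using codim by blast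
      with \<open>br x h \<notin> M\<close> have "f \<noteq> 0" by auto
      have "br h e \<in> Cs m" "br h e \<in> K" using chain_br[OF m] K_br_M h e by auto
      then have "br x (br h e) \<in> K" using Suc by simp
      moreover have "br (br x h - f *s x) e \<in> K" using K_br_M f e by simp
      \<comment> \<open>The Jacobi term [h, [x, e]] is [h, h] = 0, so \<open>f *s h\<close> is a
        difference of two elements of \<open>K\<close>, although \<open>f\<close> is
        nonzero.\<close>
      moreover have "br x (br h e) = br (br x h - f *s x) e + f *s h"
        unfolding br_br[of x h e] by (simp add: br_linear h_def)
      ultimately have "f *s h \<in> K"
        using subspace_diff[OF K_subspace, of "br x (br h e)" "br (br x h - f *s x) e"] by simp
      then show False using subspace_scale_cancel[OF K_subspace \<open>f \<noteq> 0\<close>] h by blast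
    qed
  qed
  then show ?thesis using assms Cs_top by blast
qed

lemma ideal_K: "ideal K"
  unfolding ideal_iff
proof (intro conjI allI ballI)
  fix l y assume y: "y \<in> K"
  obtain c where c: "l - c *s x \<in> M" using codim by blast
  have "br l y = br (l - c *s x) y + c *s br x y" by (simp add: br_linear)
  then show "br l y \<in> K"
    using K_br_M[OF c y] K_br_x[OF y] K_subspace by (simp add: subspace_add subspace_scale)
qed (rule K_subspace)

text \<open>It suffices that [x, L] lies in Q = K + Fx. If Q is not L, the first chain member not
  inside Q yields \<open>z\<close> outside Q with [x, z] one step lower, hence in Q. Its component
  \<open>h\<close> in \<open>M\<close> is not in \<open>K\<close>, and as \<open>K\<close> has
  codimension at most one in \<open>M\<close>, L = K + Fh + Fx.\<close>

lemma ideal_K_insert: "ideal (span (insert x K))"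
proof -
  let ?Q = "span (insert x K)"
  have Q: "y \<in> ?Q \<longleftrightarrow> (\<exists>k. y - k *s x \<in> K)" for y using mem_span_insert[OF K_subspace] .
  have KQ: "K \<subseteq> ?Q" using span_superset by blast
  have subQ: "subspace ?Q" by simp
  have C0: "Cs 0 \<subseteq> ?Q"
  proof
    fix y assume y: "y \<in> Cs 0"
    obtain c where c: "y - c *s x \<in> M" using codim by blast
    have "y - c *s x \<in> Cs 0" using y xC chain_subspace[of 0] by (simp add: subspace_diff subspace_scale)
    then obtain I where I: "ideal I" "I \<subseteq> M" "y - c *s x \<in> I" using c C_Int_M by blast
    then have "y - c *s x \<in> K" using ideal_br[OF I(1,3)] by (auto simp: K_def)
    then show "y \<in> ?Q" using Q by blast
  qed
  have x_br: "br x l \<in> ?Q" for l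
  proof (cases "?Q = UNIV")
    case False
    define j where "j = (LEAST j. \<not> Cs j \<subseteq> ?Q)"
    have ex: "\<not> Cs n \<subseteq> ?Q" using False Cs_top by auto
    have j: "\<not> Cs j \<subseteq> ?Q" "j \<le> n"
      unfolding j_def using LeastI[of "\<lambda>j. \<not> Cs j \<subseteq> ?Q", OF ex] Least_le[of "\<lambda>j. \<not> Cs j \<subseteq> ?Q", OF ex] .
    then obtain i where i: "j = Suc i" using C0 by (cases j) auto
    then have Ci: "Cs i \<subseteq> ?Q" using not_less_Least[of i "\<lambda>j. \<not> Cs j \<subseteq> ?Q"] by (simp add: j_def)
    obtain z where z: "z \<in> Cs (Suc i)" "z \<notin> ?Q" using j i by blast
    have xz: "br x z \<in> ?Q" using chain_br[of i x z] x_mem_chain[of i] z Ci i j by auto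
    obtain b where b: "z - b *s x \<in> M" using codim by blast
    define h where "h = z - b *s x"
    have "h \<notin> K" using z Q by (auto simp: h_def)
    then have h: "h \<in> M" "br x h \<notin> M" using b by (auto simp: K_def h_def)
    have xh: "br x h = br x z" by (simp add: h_def br_linear)
    obtain a where a: "l - a *s x \<in> M" using codim by blast
    define m where "m = l - a *s x"
    obtain c d where c: "br x h - c *s x \<in> M" and d: "br x m - d *s x \<in> M" using codim by blast
    have "c \<noteq> 0" using c h by auto
    \<comment> \<open>Chosen so that the multiples of \<open>x\<close> in [x, m] and k [x, h] cancel
      modulo \<open>M\<close>, which puts \<open>m - k *s h\<close> into \<open>K\<close>.\<close>
    define k where "k = d / c"
    have "br x (m - k *s h) = (br x m - d *s x) - k *s (br x h - c *s x)"
      using \<open>c \<noteq> 0\<close> by (simp add: br_linear scale_right_diff_distrib k_def)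
    then have "m - k *s h \<in> K"
      using a c d h M_subspace by (simp add: K_def m_def subspace_diff subspace_scale)
    then have "br x (m - k *s h) \<in> ?Q" using K_br_x KQ by blast
    moreover have "br x l = br x (m - k *s h) + k *s br x z"
      unfolding xh[symmetric] by (simp add: br_linear m_def)
    ultimately show ?thesis using xz subQ by (simp add: subspace_add subspace_scale)
  qed simp
  have "br l y \<in> ?Q" if y: "y \<in> ?Q" for l y
  proof -
    obtain k where k: "y - k *s x \<in> K" using y Q by blast
    have "br l y = br l (y - k *s x) - k *s br x l"
      using br_swap[of x l] by (simp add: br_linear)
    moreover have "br l (y - k *s x) \<in> ?Q" using ideal_br[OF ideal_K k] KQ by blast
    ultimately show ?thesis using x_br subQ by (simp add: subspace_diff subspace_scale)
  qed
  then show ?thesis by (simp add: ideal_iff)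
qed

end

section \<open>The strict core and the chief factor in the complemented case\<close>

lemma ideal_strict_core: "ideal (strict_core sc br C)"
proof -
  let ?S = "\<Union>{I. ideal I \<and> I \<subset> C}"
  have "br x y \<in> span ?S" if "y \<in> span ?S" for x y
    using that
  proof (induction rule: span_induct_alt)
    case base
    then show ?case by (simp add: span_zero)
  next
    case (step c y z)
    then have "br x y \<in> span ?S" using ideal_br by (intro span_base) blast
    then show ?case using step by (simp add: br_linear span_add span_scale)
  qed
  then show ?thesis unfolding strict_core_def ideal_iff[of "span ?S"] by simp
qed

lemma strict_core_subset:
  assumes "subspace T" "\<And>I. ideal I \<Longrightarrow> I \<subset> C \<Longrightarrow> I \<subseteq> T"
  shows "strict_core sc br C \<subseteq> T"
  unfolding strict_core_def using assms by (intro span_minimal) blast+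

lemma ideal_subset_strict_core: "ideal I \<Longrightarrow> I \<subset> C \<Longrightarrow> I \<subseteq> strict_core sc br C"
  unfolding strict_core_def by (rule order_trans[OF _ span_superset]) blast

text \<open>With K and Q = K + Fx the ideals found above, A meets K exactly in N and lies in Q, so
  A/N embeds into the line Q/K.\<close>

lemma complemented_chief_factor_dim:
  assumes N: "ideal N" and A: "ideal A" "N \<subset> A"
    and min: "\<And>I. ideal I \<Longrightarrow> N \<subset> I \<Longrightarrow> I \<subseteq> A \<Longrightarrow> I = A"
    and M: "max_subalg M" "N \<subseteq> M" "\<not> A \<subseteq> M"
    and C: "C \<in> S_set sc br M" "dim C = dim (strict_core sc br C) + 1"
  shows "dim A = dim N + 1"
proof -
  have sM: "subalg M" and subM: "subspace M" using M by (auto simp: maximal_subalgebra_def subalg_iff)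
  have subC: "subspace C" and CM: "\<not> C \<subseteq> M" and compl: "\<And>I. ideal I \<Longrightarrow> I \<subset> C \<Longrightarrow> I \<subseteq> M"
    and "subideal sc br C" and sum: "{m + c | m c. m \<in> M \<and> c \<in> C} = UNIV"
    using C(1) by (auto simp: S_set_def completions_def subalg_iff)
  then obtain n Cs where Cs: "Cs 0 = C" "Cs n = UNIV" "\<And>i. i < n \<Longrightarrow> lie_ideal_in sc br (Cs i) (Cs (Suc i))"
    by (auto simp: subideal_def)
  let ?k = "strict_core sc br C"
  have k: "ideal ?k" "?k \<subseteq> M" "?k \<subseteq> C"
    using ideal_strict_core strict_core_subset[OF subM compl] strict_core_subset[OF subC] by blast+
  obtain x where x: "x \<in> C" "x \<notin> M" using CM by blast
  then have xk: "x \<notin> ?k" using k by blast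
  have dec: "\<exists>c. y - c *s x \<in> ?k" if y: "y \<in> C" for y
    using codim1_decomp[OF ideal_subspace[OF k(1)] subC k(3) _ x(1) xk y] C(2) by auto
  have codim: "\<exists>c. l - c *s x \<in> M" for l
  proof -
    obtain m c where mc: "m \<in> M" "c \<in> C" "l = m + c" using sum by blast
    obtain a where "c - a *s x \<in> ?k" using dec mc by blast
    then have "m + (c - a *s x) \<in> M" using mc k subM subspace_add by blast
    then show ?thesis using mc by (auto simp: add_diff_eq)
  qed
  \<comment> \<open>\<open>C\<close> is k(C) + Fx with k(C) inside \<open>M\<close> and
    \<open>x\<close> outside, so its elements in \<open>M\<close> lie in k(C).\<close>
  have C_Int_M: "\<exists>I. ideal I \<and> I \<subseteq> M \<and> y \<in> I" if y: "y \<in> Cs 0" "y \<in> M" for y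
  proof -
    obtain a where a: "y - a *s x \<in> ?k" using dec y Cs by blast
    then have "y - (y - a *s x) \<in> M" using y k subM subspace_diff by blast
    then have "a = 0" using x subspace_scale_cancel[OF subM] by auto
    then show ?thesis using a k by auto
  qed
  have xC: "x \<in> Cs 0" using x Cs by simp
  define K where "K = {y \<in> M. br x y \<in> M}"
  note prem = sM x(2) codim Cs(2,3) xC C_Int_M
  have K: "ideal K" unfolding K_def by (rule ideal_K[OF prem])
  let ?Q = "span (insert x K)"
  have Q: "ideal ?Q" unfolding K_def by (rule ideal_K_insert[OF prem])
  note subK = ideal_subspace[OF K] and subN = ideal_subspace[OF N] and subA = ideal_subspace[OF A(1)]
  have NK: "N \<subseteq> K" using M(2) ideal_br[OF N] by (auto simp: K_def)
  have AK: "A \<inter> K = N"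
  proof (rule ccontr)
    assume "A \<inter> K \<noteq> N"
    then have "N \<subset> A \<inter> K" using NK A by blast
    then have "A \<inter> K = A" using min[OF ideal_Int[OF A(1) K]] by blast
    then show False using M(3) by (auto simp: K_def)
  qed
  have AQ: "A \<subseteq> ?Q"
  proof (cases "A \<inter> ?Q = N")
    case False
    have "K \<subseteq> ?Q" using span_superset by blast
    then have "N \<subset> A \<inter> ?Q" using False NK A by blast
    then show ?thesis using min[OF ideal_Int[OF A(1) Q]] by blast
  next
    \<comment> \<open>Then [x, A] lies in \<open>N\<close> and so in \<open>M\<close>; hence the
      component in \<open>M\<close> of any \<open>a\<close> in \<open>A\<close> belongs to
      \<open>K\<close>, and \<open>A\<close> lies in Q after all.\<close>
    case True
    show ?thesis
    proof
      fix a assume a: "a \<in> A"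
      have "x \<in> ?Q" by (simp add: span_base)
      then have "br x a \<in> A \<inter> ?Q" using ideal_br[OF A(1) a] ideal_br'[OF Q] by blast
      then have "br x a \<in> M" using True M(2) by blast
      moreover obtain c where "a - c *s x \<in> M" using codim by blast
      ultimately have "a - c *s x \<in> K" by (simp add: K_def br_linear)
      then show "a \<in> ?Q" using mem_span_insert[OF subK] by blast
    qed
  qed
  obtain v where v: "v \<in> A" "v \<notin> K" using A AK by blast
  have xK: "x \<notin> K" using x by (simp add: K_def)
  have KQ: "K \<subseteq> ?Q" using span_superset by blast
  have "A \<subseteq> span (insert v N)"
  proof
    fix a assume a: "a \<in> A"
    obtain c where "a - c *s v \<in> K"
      using codim1_decomp[OF subK _ KQ _ _ v(2), of a] dim_span_insert[OF subK xK] AQ v a by auto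
    moreover have "a - c *s v \<in> A" using a v subA by (simp add: subspace_diff subspace_scale)
    ultimately show "a \<in> span (insert v N)" using AK mem_span_insert[OF subN] by blast
  qed
  moreover have "span (insert v N) \<subseteq> A" using v A subA by (intro span_minimal) auto
  moreover have "v \<notin> N" using v NK by blast
  ultimately show ?thesis using dim_span_insert[OF subN] by (metis subset_antisym)
qed

section \<open>From completions to a flag\<close>

text \<open>Induction on the codimension of \<open>N\<close>: an ideal \<open>A\<close> of least
  dimension strictly above \<open>N\<close> is minimal over \<open>N\<close> and has a flag by
  induction, to which \<open>N\<close> is prepended.\<close>

lemma exists_ideal_flag:
  assumes hyp: "\<And>M. max_subalg M \<Longrightarrow> \<exists>C\<in>S_set sc br M. dim C = dim (strict_core sc br C) + 1"
    and "ideal N"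
  shows "\<exists>n Ls. ideal_flag N n Ls"
  using assms(2)
proof (induction "dimension - dim N" arbitrary: N rule: less_induct)
  case less
  note N = less.prems
  show ?case
  proof (cases "N = UNIV")
    case True
    then have "ideal_flag N 0 (\<lambda>_. UNIV)" by (simp add: ideal_flag_def ideal_UNIV)
    then show ?thesis by blast
  next
    case False
    then have "ideal UNIV \<and> N \<subset> UNIV" using ideal_UNIV by blast
    then obtain A where A': "ideal A \<and> N \<subset> A" and minA: "\<And>I. ideal I \<and> N \<subset> I \<Longrightarrow> dim A \<le> dim I"
      using exists_min_dim[where P = "\<lambda>I. ideal I \<and> N \<subset> I"] by (metis (no_types, lifting))
    then have A: "ideal A" "N \<subset> A" by simp_all
    have min: "I = A" if "ideal I" "N \<subset> I" "I \<subseteq> A" for I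
      using subspace_dim_equal[OF ideal_subspace[OF that(1)] ideal_subspace[OF A(1)] that(3)] minA that by blast
    have lt: "dim N < dim A" using dim_less A N ideal_subspace by blast
    then have "dimension - dim A < dimension - dim N" using dim_subset_UNIV[of A] by linarith
    then obtain n Ls where flag: "ideal_flag A n Ls" using less.hyps A by blast
    have "dim A = dim N + 1"
    proof (cases "\<exists>M. max_subalg M \<and> N \<subseteq> M \<and> \<not> A \<subseteq> M")
      case True
      then show ?thesis using complemented_chief_factor_dim[OF N A min] hyp by blast
    next
      case False
      then show ?thesis using frattini_chief_factor_dim[OF N A(2) min flag] by blast
    qed
    then show ?thesis using ideal_flag_Cons[OF flag N A(2)] by blast
  qed
qed

section \<open>From a flag to completions\<close>

lemma max_subalg_plus_ideal:
  assumes M: "max_subalg M" and C: "ideal C" "\<not> C \<subseteq> M"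
  shows "{m + c | m c. m \<in> M \<and> c \<in> C} = UNIV"
proof -
  let ?T = "{m + c | m c. m \<in> M \<and> c \<in> C}"
  have sM: "subalg M" using M by (simp add: maximal_subalgebra_def)
  then have subM: "subspace M" by (simp add: subalg_iff)
  note subC = ideal_subspace[OF C(1)]
  have "br y z \<in> ?T" if yz: "y \<in> ?T" "z \<in> ?T" for y z
  proof -
    obtain m c m' c' where y: "m \<in> M" "c \<in> C" "y = m + c" and z: "m' \<in> M" "c' \<in> C" "z = m' + c'"
      using yz by blast
    have "br y z = br m m' + (br m c' + br c z)" by (simp add: y z br_linear)
    moreover have "br m m' \<in> M" using sM y z by (simp add: subalg_iff)
    moreover have "br m c' + br c z \<in> C"
      using y z C(1) subC by (simp add: ideal_br ideal_br' subspace_add)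
    ultimately show ?thesis by blast
  qed
  then have T: "subalg ?T" using subspace_sums[OF subM subC] by (simp add: subalg_iff)
  have MT: "M \<subseteq> ?T"
  proof
    fix m assume "m \<in> M"
    then have "m + 0 \<in> ?T" using subspace_0[OF subC] by blast
    then show "m \<in> ?T" by simp
  qed
  have CT: "C \<subseteq> ?T"
  proof
    fix c assume "c \<in> C"
    then have "0 + c \<in> ?T" using subspace_0[OF subM] by blast
    then show "c \<in> ?T" by simp
  qed
  have "?T = M \<or> ?T = UNIV" using M T MT unfolding maximal_subalgebra_def by blast
  then show ?thesis using CT C(2) by auto
qed

lemma flag_completion:
  assumes flag: "ideal_flag {0} n Ls" and M: "max_subalg M"
  shows "\<exists>C\<in>S_set sc br M. dim C = dim (strict_core sc br C) + 1"
proof -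
  have subM: "subspace M" and ne: "M \<noteq> UNIV" using M by (auto simp: maximal_subalgebra_def subalg_iff)
  have "ideal UNIV \<and> \<not> UNIV \<subseteq> M" using ideal_UNIV ne by blast
  then obtain C where C': "ideal C \<and> \<not> C \<subseteq> M"
    and minC: "\<And>I. ideal I \<and> \<not> I \<subseteq> M \<Longrightarrow> dim C \<le> dim I"
    using exists_min_dim[where P = "\<lambda>I. ideal I \<and> \<not> I \<subseteq> M"] by (metis (no_types, lifting))
  then have C: "ideal C" "\<not> C \<subseteq> M" by simp_all
  note subC = ideal_subspace[OF C(1)]
  have compl: "I \<subseteq> M" if "ideal I" "I \<subset> C" for I
    using dim_less[OF ideal_subspace subC] minC that by (metis not_le)
  let ?k = "strict_core sc br C"
  have k: "ideal ?k" "?k \<subseteq> M" "?k \<subseteq> C"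
    using ideal_strict_core strict_core_subset[OF subM compl] strict_core_subset[OF subC] by blast+
  then have "?k \<subset> C" using C by blast
  then have lt: "dim ?k < dim C" using dim_less ideal_subspace[OF k(1)] subC by blast
  \<comment> \<open>The first member of the flag containing \<open>C\<close>. It is not the zeroth,
    since \<open>C\<close> is not inside \<open>M\<close> and so is nonzero.\<close>
  define j where "j = (LEAST j. C \<subseteq> Ls j)"
  have ex: "C \<subseteq> Ls n" using flag by (simp add: ideal_flag_def)
  have j: "C \<subseteq> Ls j" "j \<le> n"
    unfolding j_def using LeastI[of "\<lambda>j. C \<subseteq> Ls j", OF ex] Least_le[of "\<lambda>j. C \<subseteq> Ls j", OF ex] .
  have "\<not> C \<subseteq> Ls 0" using flag C subspace_0[OF subM] by (auto simp: ideal_flag_def)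
  then obtain i where i: "j = Suc i" using j by (cases j) auto
  then have nle: "\<not> C \<subseteq> Ls i" using not_less_Least[of i "\<lambda>j. C \<subseteq> Ls j"] by (simp add: j_def)
  have Li: "ideal (Ls i)" "ideal (Ls j)" "Ls i \<subset> Ls j" "dim (Ls j) = dim (Ls i) + 1"
    using flag i j by (auto simp: ideal_flag_def)
  obtain u where u: "u \<in> C" "u \<notin> Ls i" using nle by blast
  \<comment> \<open>This intersection is an ideal of L properly inside \<open>C\<close>, and it has
    codimension one in \<open>C\<close> because \<open>Ls i\<close> has in
    \<open>Ls j\<close>.\<close>
  have "C \<inter> Ls i \<subseteq> ?k"
    using ideal_subset_strict_core[OF ideal_Int[OF C(1) Li(1)]] nle by blast
  have "C \<subseteq> span (insert u ?k)"
  proof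
    fix y assume y: "y \<in> C"
    obtain c where "y - c *s u \<in> Ls i"
      using codim1_decomp[OF ideal_subspace[OF Li(1)] ideal_subspace[OF Li(2)] _ _ _ u(2), of y]
        Li u y j by auto
    moreover have "y - c *s u \<in> C" using y u subC by (simp add: subspace_diff subspace_scale)
    ultimately show "y \<in> span (insert u ?k)"
      using \<open>C \<inter> Ls i \<subseteq> ?k\<close> mem_span_insert[OF ideal_subspace[OF k(1)]] by blast
  qed
  then have "dim C \<le> dim (insert u ?k)" by (rule dim_mono)
  then have "dim C = dim ?k + 1" using lt by (auto simp: dim_insert split: if_splits)
  \<comment> \<open>An ideal is a subideal through the chain C, L of length one.\<close>
  moreover have "subideal sc br C"
    unfolding subideal_def
    by (rule exI[of _ 1], rule exI[of _ "\<lambda>i. if i = 0 then C else UNIV"])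
      (use C(1) in \<open>simp add: lie_ideal_def\<close>)
  then have "C \<in> S_set sc br M"
    using max_subalg_plus_ideal[OF M C] C compl ideal_subalg by (simp add: S_set_def completions_def)
  ultimately show ?thesis by blast
qed

lemma ideal_zero: "ideal {0}"
  by (simp add: ideal_iff)

lemma supersolvable_iff_completions:
  "supersolvable sc br \<longleftrightarrow>
    (\<forall>M. max_subalg M \<longrightarrow> (\<exists>C\<in>S_set sc br M. dim C = dim (strict_core sc br C) + 1))"
  unfolding supersolvable_iff_flag
  using flag_completion exists_ideal_flag[OF _ ideal_zero] by blast

end

section \<open>Transfer to the given Lie algebra, with a basis chosen inside a finite spanning
  set\<close>

theorem theorem4p2:
  fixes sc :: "'a::field \<Rightarrow> 'v::ab_group_add \<Rightarrow> 'v" and br :: "'v \<Rightarrow> 'v \<Rightarrow> 'v"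
  assumes "lie_algebra sc br" and "fin_dim sc"
  shows "supersolvable sc br \<longleftrightarrow>
    (\<forall>M. maximal_subalgebra sc br M \<longrightarrow>
       (\<exists>C\<in>S_set sc br M. vector_space.dim sc C = vector_space.dim sc (strict_core sc br C) + 1))"
proof -
  interpret vector_space sc using assms(1) by (simp add: lie_algebra_def)
  obtain S where S: "finite S" "span S = UNIV" using assms(2) by (auto simp: fin_dim_def)
  obtain B where B: "B \<subseteq> S" "independent B" "S \<subseteq> span B" by (rule maximal_independent_subset)
  have "span B = UNIV" using S B by (metis span_span span_mono top.extremum_unique)
  then interpret fin_dim_lie sc B br
    using S B assms(1) finite_subset by unfold_locales auto
  show ?thesis by (rule supersolvable_iff_completions)
qed

end
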